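(* The language $(\texttt{01})^*$ over the alphabet $\{\texttt 0,\texttt 1\}$ is definable by a sentence of $\mathsf{FOC}[+;\mathsf{MOD}]$ but cannot be recognized by any simplified stateless counter machine (that is, by any simplified stateless $k$-counter machine, for any $k$).
   Context: **The logic $\mathsf{FOC}[+;\mathsf{MOD}]$.** Fix a finite alphabet $\Sigma$. Formulas are interpreted in finite strings $w=w_1\cdots w_n\in\Sigma^*$. There are two sorts. Position variables $p,q,\dots$ range over integers in $[1,n]$. Count variables $x,y,z,\dots$ range over the rational numbers; count terms are $c_0+c_1x_1+\dots+c_kx_k$ with rational constants $c_i$ and count variables $x_i$. Formulas are: $\top$ (true), $\bot$ (false); $Q_a(p)$ for $a\in\Sigma$, true iff $w_p=a$; $\mathsf{MOD}^r_m(p)$ for integers $r\ge0$, $m>0$, true iff $p\equiv r \pmod m$; $t_1=t_2$ and $t_1<t_2$ for count terms $t_1,t_2$; $\phi_1\land\phi_2$, $\phi_1\lor\phi_2$, $\neg\phi_1$; $\exists x.\phi$ and $\forall x.\phi$ for a count variable $x$ (quantifying over the rationals); and $\exists^{=x}p.\phi$ for a count variable $x$ and position variable $p$, true iff $\phi$ is true for exactly $x$ values of $p\in[1,n]$ (this binds $p$ but leaves $x$ free). A sentence is a formula with no free variables. The language defined by a sentence $\sigma$ is $\{w\in\Sigma^*\mid w\models\sigma\}$. **Simplified stateless counter machines.** A simplified stateless $k$-counter machine ($k$-SSCM) is a tuple $M=(\Sigma,u,F)$ where $\Sigma$ is a finite alphabet, $u\colon\Sigma\to\mathbb Z^k$ is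 a counter update function, and $F\in\{0,1\}^k$ is an acceptance mask. $M$ accepts $w=w_1\cdots w_n$ if there is a sequence $c_0,\dots,c_n\in\mathbb Z^k$ such that $c_0=\mathbf 0$, $c_i=c_{i-1}+u(w_i)$ for all $i\in[1,n]$, and for every $i\in[1,k]$, $[c_n]_i=0$ iff $F_i=0$. $M$ recognizes $L$ if $L=\{w\in\Sigma^*\mid M\text{ accepts }w\}$. *)

theory Defs
  imports "HOL-Number_Theory.Cong" "Jordan_Normal_Form.Matrix"
begin

text \<open>Formulas of FOC[+;MOD] are deeply embedded; the two sorts of variables have separate name
  spaces.\<close>

type_synonym pos_var = nat
type_synonym count_var = nat

text \<open>\<open>CountTerm c\<^sub>0 [(c\<^sub>1, x\<^sub>1), \<dots>, (c\<^sub>k, x\<^sub>k)]\<close> stands for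
  \<open>c\<^sub>0 + c\<^sub>1 x\<^sub>1 + \<dots> + c\<^sub>k x\<^sub>k\<close>.\<close>

datatype count_term = CountTerm rat "(rat \<times> count_var) list"

text \<open>\<open>ModPos r m p\<close> is \<open>MOD\<^sup>r\<^sub>m(p)\<close> and \<open>ExactlyPos x p \<phi>\<close> is \<open>\<exists>\<^sup>=\<^sup>x p. \<phi>\<close>.\<close>

datatype 'a formula =
    Verum
  | Falsum
  | Sym 'a pos_var
  | ModPos nat nat pos_var
  | EqTerm count_term count_term
  | LessTerm count_term count_term
  | Conj "'a formula" "'a formula"
  | Disj "'a formula" "'a formula"
  | Neg "'a formula"
  | ExCount count_var "'a formula"
  | AllCount count_var "'a formula"
  | ExactlyPos count_var pos_var "'a formula"

text \<open>The only side condition on the syntax is that moduli are positive. It cannot be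
  dropped: congruence modulo \<open>0\<close> is equality.\<close>

primrec well_formed :: "'a formula \<Rightarrow> bool" where
  "well_formed Verum = True"
| "well_formed Falsum = True"
| "well_formed (Sym a p) = True"
| "well_formed (ModPos r m p) = (m > 0)"
| "well_formed (EqTerm s t) = True"
| "well_formed (LessTerm s t) = True"
| "well_formed (Conj \<phi> \<psi>) = (well_formed \<phi> \<and> well_formed \<psi>)"
| "well_formed (Disj \<phi> \<psi>) = (well_formed \<phi> \<and> well_formed \<psi>)"
| "well_formed (Neg \<phi>) = well_formed \<phi>"
| "well_formed (ExCount x \<phi>) = well_formed \<phi>"
| "well_formed (AllCount x \<phi>) = well_formed \<phi>"
| "well_formed (ExactlyPos x p \<phi>) = well_formed \<phi>"

primrec term_vars :: "count_term \<Rightarrow> count_var set" where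
  "term_vars (CountTerm c0 cs) = snd ` set cs"

primrec free_pos :: "'a formula \<Rightarrow> pos_var set" where
  "free_pos Verum = {}"
| "free_pos Falsum = {}"
| "free_pos (Sym a p) = {p}"
| "free_pos (ModPos r m p) = {p}"
| "free_pos (EqTerm s t) = {}"
| "free_pos (LessTerm s t) = {}"
| "free_pos (Conj \<phi> \<psi>) = free_pos \<phi> \<union> free_pos \<psi>"
| "free_pos (Disj \<phi> \<psi>) = free_pos \<phi> \<union> free_pos \<psi>"
| "free_pos (Neg \<phi>) = free_pos \<phi>"
| "free_pos (ExCount x \<phi>) = free_pos \<phi>"
| "free_pos (AllCount x \<phi>) = free_pos \<phi>"
| "free_pos (ExactlyPos x p \<phi>) = free_pos \<phi> - {p}"

primrec free_count :: "'a formula \<Rightarrow> count_var set" where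
  "free_count Verum = {}"
| "free_count Falsum = {}"
| "free_count (Sym a p) = {}"
| "free_count (ModPos r m p) = {}"
| "free_count (EqTerm s t) = term_vars s \<union> term_vars t"
| "free_count (LessTerm s t) = term_vars s \<union> term_vars t"
| "free_count (Conj \<phi> \<psi>) = free_count \<phi> \<union> free_count \<psi>"
| "free_count (Disj \<phi> \<psi>) = free_count \<phi> \<union> free_count \<psi>"
| "free_count (Neg \<phi>) = free_count \<phi>"
| "free_count (ExCount x \<phi>) = free_count \<phi> - {x}"
| "free_count (AllCount x \<phi>) = free_count \<phi> - {x}"
| "free_count (ExactlyPos x p \<phi>) = insert x (free_count \<phi>)"

definition sentence :: "'a formula \<Rightarrow> bool" where
  "sentence \<phi> \<longleftrightarrow> well_formed \<phi> \<and> free_pos \<phi> = {} \<and> free_count \<phi> = {}"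

primrec term_val :: "(count_var \<Rightarrow> rat) \<Rightarrow> count_term \<Rightarrow> rat" where
  "term_val J (CountTerm c0 cs) = c0 + (\<Sum>(c, x)\<leftarrow>cs. c * J x)"

text \<open>Positions are counted from 1 and list indices from 0, hence \<open>w ! (I p - 1)\<close>.\<close>

primrec sat :: "'a list \<Rightarrow> (pos_var \<Rightarrow> nat) \<Rightarrow> (count_var \<Rightarrow> rat) \<Rightarrow> 'a formula \<Rightarrow> bool" where
  "sat w I J Verum \<longleftrightarrow> True"
| "sat w I J Falsum \<longleftrightarrow> False"
| "sat w I J (Sym a p) \<longleftrightarrow> w ! (I p - 1) = a"
| "sat w I J (ModPos r m p) \<longleftrightarrow> [I p = r] (mod m)"
| "sat w I J (EqTerm s t) \<longleftrightarrow> term_val J s = term_val J t"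
| "sat w I J (LessTerm s t) \<longleftrightarrow> term_val J s < term_val J t"
| "sat w I J (Conj \<phi> \<psi>) \<longleftrightarrow> sat w I J \<phi> \<and> sat w I J \<psi>"
| "sat w I J (Disj \<phi> \<psi>) \<longleftrightarrow> sat w I J \<phi> \<or> sat w I J \<psi>"
| "sat w I J (Neg \<phi>) \<longleftrightarrow> \<not> sat w I J \<phi>"
| "sat w I J (ExCount x \<phi>) \<longleftrightarrow> (\<exists>v. sat w I (J(x := v)) \<phi>)"
| "sat w I J (AllCount x \<phi>) \<longleftrightarrow> (\<forall>v. sat w I (J(x := v)) \<phi>)"
| "sat w I J (ExactlyPos x p \<phi>) \<longleftrightarrow>
     of_nat (card {i \<in> {1..length w}. sat w (I(p := i)) J \<phi>}) = J x"

text \<open>A sentence has the same truth value under all assignments (\<open>sat_sentence\<close> below), so the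
  quantification over assignments is immaterial. It is deliberately not restricted to
  assignments into \<open>{1..length w}\<close>, of which there are none for the empty string.\<close>

definition models :: "'a list \<Rightarrow> 'a formula \<Rightarrow> bool" (infix "\<Turnstile>" 50) where
  "w \<Turnstile> \<phi> \<longleftrightarrow> (\<forall>I J. sat w I J \<phi>)"

definition foc_mod_definable :: "'a::finite list set \<Rightarrow> bool" where
  "foc_mod_definable L \<longleftrightarrow> (\<exists>\<sigma>. sentence \<sigma> \<and> L = {w. w \<Turnstile> \<sigma>})"

lemma term_val_cong:
  assumes "\<And>x. x \<in> term_vars t \<Longrightarrow> J x = J' x"
  shows "term_val J t = term_val J' t"
proof (cases t)
  case (CountTerm c0 cs)
  have "map (\<lambda>(c, x). c * J x) cs = map (\<lambda>(c, x). c * J' x) cs"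
  proof (rule map_cong[OF refl])
    fix y assume y: "y \<in> set cs"
    then have "snd y \<in> term_vars t"
      using CountTerm by simp
    then have "J (snd y) = J' (snd y)"
      by (rule assms)
    then show "(\<lambda>(c, x). c * J x) y = (\<lambda>(c, x). c * J' x) y"
      by (simp add: case_prod_beta)
  qed
  then show ?thesis
    by (simp only: CountTerm term_val.simps)
qed

lemma sat_cong:
  assumes "\<And>p. p \<in> free_pos \<phi> \<Longrightarrow> I p = I' p"
    and "\<And>x. x \<in> free_count \<phi> \<Longrightarrow> J x = J' x"
  shows "sat w I J \<phi> \<longleftrightarrow> sat w I' J' \<phi>"
  using assms
proof (induction \<phi> arbitrary: I I' J J')
  case (EqTerm s t)
  then have "term_val J s = term_val J' s" "term_val J t = term_val J' t"
    by (auto intro: term_val_cong)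
  then show ?case by simp
next
  case (LessTerm s t)
  then have "term_val J s = term_val J' s" "term_val J t = term_val J' t"
    by (auto intro: term_val_cong)
  then show ?case by simp
next
  case (Conj \<phi> \<psi>)
  have "sat w I J \<phi> \<longleftrightarrow> sat w I' J' \<phi>"
    by (rule Conj.IH(1)) (use Conj.prems in auto)
  moreover have "sat w I J \<psi> \<longleftrightarrow> sat w I' J' \<psi>"
    by (rule Conj.IH(2)) (use Conj.prems in auto)
  ultimately show ?case by simp
next
  case (Disj \<phi> \<psi>)
  have "sat w I J \<phi> \<longleftrightarrow> sat w I' J' \<phi>"
    by (rule Disj.IH(1)) (use Disj.prems in auto)
  moreover have "sat w I J \<psi> \<longleftrightarrow> sat w I' J' \<psi>"
    by (rule Disj.IH(2)) (use Disj.prems in auto)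
  ultimately show ?case by simp
next
  case (Neg \<phi>)
  have "sat w I J \<phi> \<longleftrightarrow> sat w I' J' \<phi>"
    by (rule Neg.IH) (use Neg.prems in auto)
  then show ?case by simp
next
  case (ExCount x \<phi>)
  have "sat w I (J(x := v)) \<phi> \<longleftrightarrow> sat w I' (J'(x := v)) \<phi>" for v
    by (rule ExCount.IH) (use ExCount.prems in auto)
  then show ?case by simp
next
  case (AllCount x \<phi>)
  have "sat w I (J(x := v)) \<phi> \<longleftrightarrow> sat w I' (J'(x := v)) \<phi>" for v
    by (rule AllCount.IH) (use AllCount.prems in auto)
  then show ?case by simp
next
  case (ExactlyPos x p \<phi>)
  have "sat w (I(p := i)) J \<phi> \<longleftrightarrow> sat w (I'(p := i)) J' \<phi>" for i
    by (rule ExactlyPos.IH) (use ExactlyPos.prems in auto)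
  moreover have "J x = J' x"
    using ExactlyPos.prems by simp
  ultimately show ?case by simp
qed simp_all

lemma sat_sentence:
  assumes "sentence \<sigma>"
  shows "sat w I J \<sigma> \<longleftrightarrow> w \<Turnstile> \<sigma>"
proof -
  have "sat w I J \<sigma> \<longleftrightarrow> sat w I' J' \<sigma>" for I' J'
    by (rule sat_cong) (use assms in \<open>auto simp: sentence_def\<close>)
  then show ?thesis
    unfolding models_def by metis
qed

text \<open>Simplified stateless counter machines (SSCMs). The acceptance mask in \<open>{0,1}\<^sup>k\<close> is a Boolean vector, with \<open>False\<close> for \<open>0\<close> and \<open>True\<close> for \<open>1\<close>.
  The alphabet is the type \<open>'a\<close>.\<close>

record 'a sscm =
  counter_update :: "'a \<Rightarrow> int vec"
  mask :: "bool vec"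

definition is_sscm :: "nat \<Rightarrow> ('a::finite) sscm \<Rightarrow> bool" where
  "is_sscm k M \<longleftrightarrow> (\<forall>a. counter_update M a \<in> carrier_vec k) \<and> mask M \<in> carrier_vec k"

definition sscm_accepts :: "nat \<Rightarrow> ('a::finite) sscm \<Rightarrow> 'a list \<Rightarrow> bool" where
  "sscm_accepts k M w \<longleftrightarrow>
     (\<exists>c :: nat \<Rightarrow> int vec.
        (\<forall>i\<le>length w. c i \<in> carrier_vec k) \<and>
        c 0 = 0\<^sub>v k \<and>
        (\<forall>i<length w. c (Suc i) = c i + counter_update M (w ! i)) \<and>
        (\<forall>i<k. c (length w) $ i = 0 \<longleftrightarrow> mask M $ i = False))"

definition sscm_recognizes :: "nat \<Rightarrow> ('a::finite) sscm \<Rightarrow> 'a list set \<Rightarrow> bool" where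
  "sscm_recognizes k M L \<longleftrightarrow> L = {w. sscm_accepts k M w}"

datatype letter = Zero | One

instance letter :: finite
proof
  have "(UNIV :: letter set) = {Zero, One}"
    using letter.exhaust by blast
  then show "finite (UNIV :: letter set)"
    by (metis finite.emptyI finite.insertI)
qed

definition zero_one_star :: "letter list set" where
  "zero_one_star = {concat (replicate n [Zero, One]) | n. True}"

end

theory Submission
  imports Defs
begin

text \<open>A string is in \<open>(01)\<^sup>*\<close> iff its odd positions carry \<open>0\<close>, its even positions carry \<open>1\<close>, and its
  length is even; the last condition says that there are as many odd as even positions, which
  counting quantifiers and modular predicates express. A stateless counter machine only sees the
  total counter update, so it cannot distinguish \<open>01\<close> from \<open>10\<close>.\<close>

lemma concat_replicate_pair_nth:
  "i < 2 * n \<Longrightarrow> concat (replicate n [a, b]) ! i = (if even i then a else b)"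
proof (induction n arbitrary: i)
  case (Suc n)
  show ?case
  proof (cases "i < 2")
    case True
    then have "i = 0 \<or> i = 1" by auto
    then show ?thesis by auto
  next
    case False
    then obtain j where "i = Suc (Suc j)"
      by (metis One_nat_def less_2_cases_iff not0_implies_Suc)
    then show ?thesis using Suc by simp
  qed
qed simp

lemma length_concat_replicate: "length (concat (replicate n xs)) = n * length xs"
  by (induction n) simp_all

text \<open>Replaces the concatenation by conditions on length and single letters, the form that the
  formula can express. List indices start at 0, so even indices are the odd positions.\<close>

lemma zero_one_star_iff:
  "w \<in> zero_one_star \<longleftrightarrow>
     even (length w) \<and> (\<forall>i<length w. w ! i = (if even i then Zero else One))"
proof
  assume "w \<in> zero_one_star"
  then show "even (length w) \<and> (\<forall>i<length w. w ! i = (if even i then Zero else One))"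
    by (auto simp: zero_one_star_def length_concat_replicate concat_replicate_pair_nth)
next
  assume w: "even (length w) \<and> (\<forall>i<length w. w ! i = (if even i then Zero else One))"
  then obtain n where n: "length w = 2 * n" by blast
  have "w = concat (replicate n [Zero, One])"
    by (rule nth_equalityI) (use w n in \<open>auto simp: length_concat_replicate concat_replicate_pair_nth\<close>)
  then show "w \<in> zero_one_star" unfolding zero_one_star_def by blast
qed

lemma card_even_odd_upto:
  "card {i \<in> {1..n}. even i} = n div 2" "card {i \<in> {1..n}. odd i} = (n + 1) div 2"
proof (induction n)
  case (Suc n)
  \<comment> \<open>Splitting off the last position for an arbitrary \<open>P\<close> serves both
    parities at once.\<close>
  have "{i \<in> {1..Suc n}. P i} =
      (if P (Suc n) then insert (Suc n) {i \<in> {1..n}. P i} else {i \<in> {1..n}. P i})" for P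
    by (auto simp: le_Suc_eq)
  then show "card {i \<in> {1..Suc n}. even i} = Suc n div 2"
    and "card {i \<in> {1..Suc n}. odd i} = (Suc n + 1) div 2"
    using Suc by simp_all
qed simp_all

text \<open>The first conjunct encodes even length: a single value counts both the even and the odd
  positions. The second says that no position carries a wrong letter; a counting quantifier takes
  only a variable, so the number 0 enters as a bound variable equated with the constant term
  \<open>CountTerm 0 []\<close>. Position and count variables have separate name spaces, so both can
  be called 0.\<close>

definition zero_one_formula :: "letter formula" where
  "zero_one_formula =
     Conj
       (ExCount 0 (Conj (ExactlyPos 0 0 (ModPos 0 2 0)) (ExactlyPos 0 0 (ModPos 1 2 0))))
       (ExCount 0 (Conj (EqTerm (CountTerm 0 [(1, 0)]) (CountTerm 0 []))
         (ExactlyPos 0 0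
           (Disj (Conj (ModPos 1 2 0) (Neg (Sym Zero 0)))
                 (Conj (ModPos 0 2 0) (Neg (Sym One 0)))))))"

lemma sentence_zero_one_formula: "sentence zero_one_formula"
  by (simp add: sentence_def zero_one_formula_def)

lemma models_zero_one_formula: "w \<Turnstile> zero_one_formula \<longleftrightarrow> w \<in> zero_one_star"
proof -
  let ?bad = "{i \<in> {1..length w}. odd i \<and> w ! (i - 1) \<noteq> Zero \<or> even i \<and> w ! (i - 1) \<noteq> One}"
  have mod2: "[i = 0] (mod 2) \<longleftrightarrow> even i" "[i = Suc 0] (mod 2) \<longleftrightarrow> odd i" for i :: nat
    by (simp_all add: cong_def even_iff_mod_2_eq_zero odd_iff_mod_2_eq_one)
  \<comment> \<open>The bound count variables are determined by the cardinalities, so each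
    existential reduces to an equation between natural numbers.\<close>
  have "w \<Turnstile> zero_one_formula \<longleftrightarrow>
      card {i \<in> {1..length w}. even i} = card {i \<in> {1..length w}. odd i} \<and> card ?bad = 0"
    unfolding models_def zero_one_formula_def by (simp add: mod2 del: card_0_eq) auto
  also have "card {i \<in> {1..length w}. even i} = card {i \<in> {1..length w}. odd i} \<longleftrightarrow> even (length w)"
    unfolding card_even_odd_upto by presburger
  also have "card ?bad = 0 \<longleftrightarrow> (\<forall>i\<in>{1..length w}. w ! (i - 1) = (if odd i then Zero else One))"
    by auto
  \<comment> \<open>Passing from positions to indices shifts by one and so swaps the
    parities.\<close>
  also have "\<dots> \<longleftrightarrow> (\<forall>i<length w. w ! i = (if even i then Zero else One))"
    unfolding image_Suc_lessThan[symmetric] by (simp add: lessThan_def)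
  finally show ?thesis by (simp add: zero_one_star_iff)
qed

text \<open>The run is forced by the input: each counter ends at the sum of its updates over the
  letters. Acceptance is therefore invariant under permuting the string.\<close>

lemma sscm_accepts_iff:
  assumes "is_sscm k M"
  shows "sscm_accepts k M w \<longleftrightarrow>
    (\<forall>i<k. (\<Sum>a\<leftarrow>w. counter_update M a $ i) = 0 \<longleftrightarrow> \<not> mask M $ i)"
proof
  have u: "counter_update M a \<in> carrier_vec k" for a
    using assms by (simp add: is_sscm_def)
  {
    assume "sscm_accepts k M w"
    then obtain c where c: "\<forall>i\<le>length w. c i \<in> carrier_vec k" "c 0 = 0\<^sub>v k"
      "\<forall>i<length w. c (Suc i) = c i + counter_update M (w ! i)"
      "\<forall>i<k. c (length w) $ i = 0 \<longleftrightarrow> mask M $ i = False"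
      unfolding sscm_accepts_def by blast
    have "c n $ i = (\<Sum>a\<leftarrow>take n w. counter_update M a $ i)"
      if "i < k" "n \<le> length w" for i n
      using that(2)
    proof (induction n)
      case 0
      then show ?case using c(2) that(1) by simp
    next
      case (Suc n)
      then show ?case
        using c(3) that(1) u[of "w ! n"] by (simp add: take_Suc_conv_app_nth)
    qed
    from this[of _ "length w"]
    show "\<forall>i<k. (\<Sum>a\<leftarrow>w. counter_update M a $ i) = 0 \<longleftrightarrow> \<not> mask M $ i"
      using c(4) by simp
  }
  assume acc: "\<forall>i<k. (\<Sum>a\<leftarrow>w. counter_update M a $ i) = 0 \<longleftrightarrow> \<not> mask M $ i"
  \<comment> \<open>The prefix sums of the updates serve as the accepting run.\<close>
  define c where "c n = vec k (\<lambda>i. \<Sum>a\<leftarrow>take n w. counter_update M a $ i)" for n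
  have "c (Suc i) = c i + counter_update M (w ! i)" if "i < length w" for i
    using that u[of "w ! i"] by (intro eq_vecI) (auto simp: c_def take_Suc_conv_app_nth)
  moreover have "c 0 = 0\<^sub>v k"
    by (intro eq_vecI) (auto simp: c_def)
  moreover have "c i \<in> carrier_vec k" for i
    by (simp add: c_def)
  moreover have "\<forall>i<k. c (length w) $ i = 0 \<longleftrightarrow> mask M $ i = False"
    using acc by (simp add: c_def)
  ultimately show "sscm_accepts k M w"
    unfolding sscm_accepts_def by blast
qed

theorem proposition10:
  shows "foc_mod_definable zero_one_star \<and>
    \<not> (\<exists>(k::nat) (M :: letter sscm). is_sscm k M \<and> sscm_recognizes k M zero_one_star)"
proof
  show "foc_mod_definable zero_one_star"
    unfolding foc_mod_definable_def
    using sentence_zero_one_formula models_zero_one_formula by blast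
  show "\<not> (\<exists>(k::nat) (M :: letter sscm). is_sscm k M \<and> sscm_recognizes k M zero_one_star)"
  proof
    assume "\<exists>(k::nat) (M :: letter sscm). is_sscm k M \<and> sscm_recognizes k M zero_one_star"
    then obtain k and M :: "letter sscm"
      where M: "is_sscm k M" "sscm_recognizes k M zero_one_star" by blast
    \<comment> \<open>The two strings have the same letters, hence equal sums by commutativity, but
      only the first lies in the language.\<close>
    have "sscm_accepts k M [Zero, One] \<longleftrightarrow> sscm_accepts k M [One, Zero]"
      by (simp add: sscm_accepts_iff[OF M(1)] add.commute)
    then have "[Zero, One] \<in> zero_one_star \<longleftrightarrow> [One, Zero] \<in> zero_one_star"
      using M(2) unfolding sscm_recognizes_def by blast
    then show False
      by (simp add: zero_one_star_iff All_less_Suc)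
  qed
qed

end
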